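(* Let $P_{5,2}$ be the Petersen graph and let $K_{1,n}$ be the star with $n$ leaves, where $n\ge 3$. Then $$\mathrm{rn}(P_{5,2}\Box K_{1,n})=10n+27.$$
   Context: Radio labeling: for a connected graph $G$, a radio labeling is a map $f:V(G)\to\{0,1,2,\ldots\}$ with $|f(u)-f(v)|\ge \mathrm{diam}(G)+1-d_G(u,v)$ for all distinct $u,v\in V(G)$. Its span is $\max\{|f(u)-f(v)|:u,v\in V(G)\}$, and the radio number $\mathrm{rn}(G)$ is the minimum span over all radio labelings of $G$. The Petersen graph $P_{5,2}$ has vertex set $\{u_i,v_i:i\in\mathbb{Z}_5\}$ and edge set $\{u_iu_{i+1},\,u_iv_i,\,v_iv_{i+2}:i\in\mathbb{Z}_5\}$. The star $K_{1,n}$ is the tree with vertices $y_0,y_1,\ldots,y_n$ and edges $y_0y_j$ for $1\le j\le n$. Cartesian product: $G\Box H$ has vertex set $V(G)\times V(H)$, with $(g,h)$ and $(g',h')$ adjacent iff ($g g'\in E(G)$ and $h=h'$) or ($g=g'$ and $hh'\in E(H)$). *)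

theory Defs
  imports "Graph_Theory.Graph_Theory"
begin

text \<open>
  A simple undirected graph is represented as in the library: a symmetric loop-free digraph
  without parallel arcs (locale \<open>pair_graph\<close>), each edge $uv$ being given by the two arcs
  $(u,v)$ and $(v,u)$.
\<close>

section \<open>Distance, diameter, radio number\<close>

text \<open>
  The distance is meant for pairs of vertices joined by a walk; on an empty set of lengths the
  infimum of natural numbers is a junk value. The diameter is meant for finite nonempty graphs.
  All graphs in question are finite and connected, see below.
\<close>

definition gdist :: "('a, 'b) pre_digraph \<Rightarrow> 'a \<Rightarrow> 'a \<Rightarrow> nat" where
  "gdist G u v = Inf {length p | p. pre_digraph.awalk G u p v}"

definition diam :: "('a, 'b) pre_digraph \<Rightarrow> nat" where
  "diam G = Max {gdist G u v | u v. u \<in> verts G \<and> v \<in> verts G}"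

text \<open>
  Only the values of a labeling on the vertices of the graph matter. The condition is stated
  over the integers, since subtraction of natural numbers truncates.
\<close>

definition radio_labeling :: "('a, 'b) pre_digraph \<Rightarrow> ('a \<Rightarrow> nat) \<Rightarrow> bool" where
  "radio_labeling G f \<longleftrightarrow>
     (\<forall>u\<in>verts G. \<forall>v\<in>verts G. u \<noteq> v \<longrightarrow>
        \<bar>int (f u) - int (f v)\<bar> \<ge> int (diam G) + 1 - int (gdist G u v))"

definition label_span :: "('a, 'b) pre_digraph \<Rightarrow> ('a \<Rightarrow> nat) \<Rightarrow> nat" where
  "label_span G f = Max {nat \<bar>int (f u) - int (f v)\<bar> | u v. u \<in> verts G \<and> v \<in> verts G}"

text \<open>
  The infimum of a nonempty set of natural numbers is its minimum; radio labelings of a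
  finite graph exist (lemma \<open>radio_labeling_exists\<close>).
\<close>

definition radio_number :: "('a, 'b) pre_digraph \<Rightarrow> nat" where
  "radio_number G = Inf {label_span G f | f. radio_labeling G f}"

lemma radio_labeling_exists:
  assumes "finite (verts G)"
  shows "\<exists>f. radio_labeling G f"
proof -
  obtain h :: "'a \<Rightarrow> nat" where h: "inj_on h (verts G)"
    using finite_imp_inj_to_nat_seg[OF assms] by blast
  define c where "c = diam G + 1"
  have c: "int c = int (diam G) + 1"
    by (simp add: c_def)
  have "int c - int (gdist G u v) \<le> \<bar>int (c * h u) - int (c * h v)\<bar>"
    if "u \<in> verts G" "v \<in> verts G" "u \<noteq> v" for u v
  proof -
    have "h u \<noteq> h v"
      using h that by (auto simp: inj_on_def)
    then have "1 \<le> \<bar>int (h u) - int (h v)\<bar>"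
      by linarith
    then have "int c * 1 \<le> int c * \<bar>int (h u) - int (h v)\<bar>"
      by (rule mult_left_mono) simp
    also have "\<dots> = \<bar>int c * (int (h u) - int (h v))\<bar>"
      by (simp only: abs_mult abs_of_nat)
    also have "\<dots> = \<bar>int (c * h u) - int (c * h v)\<bar>"
      by (simp only: right_diff_distrib of_nat_mult)
    finally show ?thesis
      by (metis diff_le_eq add_increasing2 mult_1_right of_nat_0_le_iff)
  qed
  then show ?thesis
    unfolding radio_labeling_def c[symmetric] by (intro exI[of _ "\<lambda>x. c * h x"] ballI impI)
qed

section \<open>The Petersen graph, stars, Cartesian products\<close>

text \<open>
  The constructors \<open>U\<close> and \<open>V\<close> give the vertices $u_i$ and $v_i$, with $i \in \mathbb{Z}_5$
  represented by its residue in $\{0, \ldots, 4\}$.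
\<close>

datatype petersen_vertex = U nat | V nat

definition petersen :: "petersen_vertex pair_pre_digraph" where
  "petersen =
     (let E = (\<Union>i<5. {(U i, U ((i + 1) mod 5)), (U i, V i), (V i, V ((i + 2) mod 5))})
      in \<lparr> pverts = U ` {..<5} \<union> V ` {..<5}, parcs = E \<union> E\<inverse> \<rparr>)"

definition star :: "nat \<Rightarrow> nat pair_pre_digraph" where
  "star n = (let E = {(0, j) | j. 1 \<le> j \<and> j \<le> n} in \<lparr> pverts = {0..n}, parcs = E \<union> E\<inverse> \<rparr>)"

definition box_product ::
  "'a pair_pre_digraph \<Rightarrow> 'b pair_pre_digraph \<Rightarrow> ('a \<times> 'b) pair_pre_digraph" (infixl "\<box>" 70)
  where
  "G \<box> H = \<lparr> pverts = pverts G \<times> pverts H,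
     parcs = {((g, h), (g', h')).
       (g, g') \<in> parcs G \<and> h \<in> pverts H \<and> h = h' \<or>
       g \<in> pverts G \<and> g = g' \<and> (h, h') \<in> parcs H} \<rparr>"

text \<open>These are finite simple graphs, and connected.\<close>

lemma pair_graph_petersen: "pair_graph petersen"
proof -
  have "Suc i mod 5 \<noteq> i" "Suc (Suc i) mod 5 \<noteq> i" for i :: nat
    by presburger+
  moreover from this have "i \<noteq> Suc i mod 5" "i \<noteq> Suc (Suc i) mod 5" for i :: nat
    by metis+
  ultimately show ?thesis
    by unfold_locales (auto simp: petersen_def Let_def symmetric_def sym_def)
qed

lemma pair_graph_star: "pair_graph (star n)"
proof -
  have "parcs (star n) \<subseteq> {0..n} \<times> {0..n}"
    by (auto simp: star_def Let_def)
  then have "finite (parcs (star n))"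
    by (rule finite_subset) simp
  then show ?thesis
    by unfold_locales (auto simp: star_def Let_def symmetric_def sym_def)
qed

lemma pair_graph_box_product:
  assumes "pair_graph G" "pair_graph H"
  shows "pair_graph (G \<box> H)"
proof -
  interpret G: pair_graph G by fact
  interpret H: pair_graph H by fact
  have GV: "a \<in> pverts G" "b \<in> pverts G" if "(a, b) \<in> parcs G" for a b
    using G.arc_fst_in_verts[OF that] G.arc_snd_in_verts[OF that] by auto
  have HV: "a \<in> pverts H" "b \<in> pverts H" if "(a, b) \<in> parcs H" for a b
    using H.arc_fst_in_verts[OF that] H.arc_snd_in_verts[OF that] by auto
  have sub: "parcs (G \<box> H) \<subseteq> (pverts G \<times> pverts H) \<times> (pverts G \<times> pverts H)"
    by (auto simp: box_product_def dest: GV HV)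
  have fin: "finite (pverts (G \<box> H))"
    by (simp add: box_product_def G.pair_finite_verts H.pair_finite_verts)
  have "finite (parcs (G \<box> H))"
    using finite_subset[OF sub] G.pair_finite_verts H.pair_finite_verts by simp
  moreover have "sym (parcs (G \<box> H))"
    by (auto simp: box_product_def sym_def intro: G.arcs_symmetric H.arcs_symmetric)
  moreover have "fst e \<noteq> snd e" if "e \<in> parcs (G \<box> H)" for e
    using that by (auto simp: box_product_def dest: G.pair_no_loops H.pair_no_loops)
  moreover have "fst e \<in> pverts (G \<box> H)" "snd e \<in> pverts (G \<box> H)" if "e \<in> parcs (G \<box> H)" for e
    using that sub by (force simp: box_product_def)+
  ultimately show ?thesis
    using fin by unfold_locales (auto simp: symmetric_def)
qed

lemma strongly_connected_via:
  assumes "pair_graph G" "r \<in> pverts G" "\<And>v. v \<in> pverts G \<Longrightarrow> (r, v) \<in> (parcs G)\<^sup>*"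
  shows "strongly_connected G"
proof -
  interpret pair_graph G by fact
  have R: "r \<rightarrow>\<^sup>*\<^bsub>G\<^esub> v" if "v \<in> pverts G" for v
    using assms(3)[OF that]
  proof (induction rule: rtrancl_induct)
    case base
    then show ?case using assms(2) by simp
  next
    case (step y z)
    then show ?case by (auto intro: reachable_adj_trans)
  qed
  have "u \<rightarrow>\<^sup>*\<^bsub>G\<^esub> v" if "u \<in> pverts G" "v \<in> pverts G" for u v
    by (rule reachable_trans[OF symmetric_reachable[OF sym_arcs R[OF that(1)]] R[OF that(2)]])
  then show ?thesis
    using assms(2) unfolding strongly_connected_def by auto
qed

lemma strongly_connected_rtrancl:
  assumes "pair_graph G" "strongly_connected G" "u \<in> pverts G" "v \<in> pverts G"
  shows "(u, v) \<in> (parcs G)\<^sup>*"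
proof -
  have "(u, v) \<in> rtrancl_on (pverts G) (parcs G)"
    using assms by (simp add: strongly_connected_def reachable_def)
  then show ?thesis
    by induction (auto intro: rtrancl.rtrancl_into_rtrancl)
qed

lemma strongly_connected_petersen: "strongly_connected petersen"
proof (rule strongly_connected_via[OF pair_graph_petersen, of "U 0"])
  fix v assume v: "v \<in> pverts petersen"
  have U: "(U 0, U i) \<in> (parcs petersen)\<^sup>*" if "i < 5" for i
    using that
  proof (induction i)
    case (Suc i)
    then have "(U i, U (Suc i)) \<in> parcs petersen"
      by (auto simp: petersen_def Let_def intro!: bexI[of _ i])
    with Suc show ?case by (auto intro: rtrancl.rtrancl_into_rtrancl)
  qed simp
  moreover have "(U i, V i) \<in> parcs petersen" if "i < 5" for i
    using that by (auto simp: petersen_def Let_def)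
  ultimately show "(U 0, v) \<in> (parcs petersen)\<^sup>*"
    using v by (auto simp: petersen_def Let_def intro: rtrancl.rtrancl_into_rtrancl)
qed (simp add: petersen_def Let_def)

lemma strongly_connected_star: "strongly_connected (star n)"
proof (rule strongly_connected_via[OF pair_graph_star, of 0])
  fix v assume "v \<in> pverts (star n)"
  then show "(0, v) \<in> (parcs (star n))\<^sup>*"
    by (cases "v = 0") (auto simp: star_def Let_def)
qed (simp add: star_def Let_def)

lemma strongly_connected_box_product:
  assumes G: "pair_graph G" "strongly_connected G" and H: "pair_graph H" "strongly_connected H"
  shows "strongly_connected (G \<box> H)"
proof -
  obtain g h where gh: "g \<in> pverts G" "h \<in> pverts H"
    using G(2) H(2) by (auto simp: strongly_connected_def)
  have 1: "((a, h), (b, h)) \<in> (parcs (G \<box> H))\<^sup>*" if "(a, b) \<in> (parcs G)\<^sup>*" for a b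
    using that
    by induction (use gh in \<open>auto simp: box_product_def intro: rtrancl.rtrancl_into_rtrancl\<close>)
  have 2: "((a, c), (a, d)) \<in> (parcs (G \<box> H))\<^sup>*" if "(c, d) \<in> (parcs H)\<^sup>*" "a \<in> pverts G" for a c d
    using that
    by induction (auto simp: box_product_def intro: rtrancl.rtrancl_into_rtrancl)
  show ?thesis
  proof (rule strongly_connected_via[OF pair_graph_box_product[OF G(1) H(1)], of "(g, h)"])
    fix v assume "v \<in> pverts (G \<box> H)"
    then obtain a b where ab: "v = (a, b)" "a \<in> pverts G" "b \<in> pverts H"
      by (auto simp: box_product_def)
    then show "((g, h), v) \<in> (parcs (G \<box> H))\<^sup>*"
      using rtrancl_trans[OF 1[OF strongly_connected_rtrancl[OF G gh(1) ab(2)]]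
          2[OF strongly_connected_rtrancl[OF H gh(2) ab(3)] ab(2)]] by simp
  qed (use gh in \<open>simp add: box_product_def\<close>)
qed

end

theory Submission
  imports Defs
begin

text \<open>
  Write \<open>G\<close> for the product. Distances add in a Cartesian product, so \<open>G\<close> has diameter
  $2 + 2 = 4$, and giving the level $0$ to the ten vertices over the centre of the star and the
  level $1$ to the $10n$ vertices over its leaves, the distance of two vertices is at most
  $2$ plus the sum of their levels.

  \<^bold>\<open>Lower bound.\<close> List the $10n + 10$ vertices by increasing label. A step of the list from $x$
  to $y$ costs at least $5 - d(x, y)$, that is, at least $3$ minus the two levels. In the sum over
  the $10n + 9$ steps each level occurs at most twice, so the span is at least
  $3(10n + 9) - 2 \cdot 10n = 10n + 27$ (\<open>label_span_ge_weighted\<close>).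

  \<^bold>\<open>Upper bound.\<close> Equality forces every step to join vertices with distinct nonadjacent Petersen
  coordinates that are not over the same leaf, and the list to begin and end over the centre. Such
  a list also has to satisfy the conditions for vertices that are two or three steps apart. Over the
  leaves it is a table of ten rows and $n$ columns, read row by row, with consecutive labels. Column
  \<open>j\<close> stands for the leaf \<open>j + 1\<close> and contains every Petersen vertex once. The columns are of
  only four kinds, given by the function \<open>row\<close>, so that finitely many checks in the Petersen graph
  (\<open>same_row_far\<close>, \<open>same_row_neq\<close>, \<open>next_row_far\<close>, \<open>next_row_neq\<close>) settle all
  \<open>n\<close>. The kinds are chosen to be cyclic in the rows; the vertices over the centre, listed in the
  order of the column of kind $0$, then fit before and after the table as if they were the
  first entries of further rows.
\<close>

section \<open>Distances in Cartesian products\<close>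

lemma awalk_of_length_iff_relpow:
  assumes "pair_graph G" "u \<in> pverts G"
  shows "(\<exists>p. pre_digraph.awalk G u p v \<and> length p = k) \<longleftrightarrow> (u, v) \<in> parcs G ^^ k"
proof -
  interpret pair_graph G by fact
  show ?thesis
    using assms(2)
  proof (induction k arbitrary: u)
    case 0
    then show ?case by (auto simp: awalk_Nil_iff)
  next
    case (Suc k)
    have verts: "w \<in> pverts G" if "(u, w) \<in> parcs G" for w
      using arc_snd_in_verts[OF that] by simp
    show ?case
    proof
      assume "\<exists>p. awalk u p v \<and> length p = Suc k"
      then obtain e p where p: "awalk u (e # p) v" "length p = k"
        by (auto simp: length_Suc_conv)
      then have "(u, snd e) \<in> parcs G" "awalk (snd e) p v"
        by (auto simp: awalk_Cons_iff)
      moreover from this have "(snd e, v) \<in> parcs G ^^ k"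
        using Suc.IH[OF verts] p(2) by blast
      ultimately show "(u, v) \<in> parcs G ^^ Suc k"
        using relpow_Suc_I2 by metis
    next
      assume "(u, v) \<in> parcs G ^^ Suc k"
      then obtain w where w: "(u, w) \<in> parcs G" "(w, v) \<in> parcs G ^^ k"
        by (rule relpow_Suc_E2)
      then obtain p where "awalk w p v" "length p = k"
        using Suc.IH[OF verts] by blast
      with w(1) have "awalk u ((u, w) # p) v \<and> length ((u, w) # p) = Suc k"
        by (simp add: awalk_Cons_iff)
      then show "\<exists>p. awalk u p v \<and> length p = Suc k" ..
    qed
  qed
qed

lemma gdist_eq_Least_relpow:
  assumes "pair_graph G" "u \<in> pverts G"
  shows "gdist G u v = (LEAST k. (u, v) \<in> parcs G ^^ k)"
proof -
  have "{length p | p. pre_digraph.awalk G u p v} = {k. (u, v) \<in> parcs G ^^ k}"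
    unfolding awalk_of_length_iff_relpow[OF assms, symmetric] by blast
  then show ?thesis by (simp add: gdist_def Inf_nat_def)
qed

lemma gdist_le:
  assumes "pair_graph G" "u \<in> pverts G" "(u, v) \<in> parcs G ^^ k"
  shows "gdist G u v \<le> k"
  unfolding gdist_eq_Least_relpow[OF assms(1,2)] using assms(3) by (rule Least_le)

lemma relpow_gdist:
  assumes "pair_graph G" "strongly_connected G" "u \<in> pverts G" "v \<in> pverts G"
  shows "(u, v) \<in> parcs G ^^ gdist G u v"
proof -
  obtain k where "(u, v) \<in> parcs G ^^ k"
    using strongly_connected_rtrancl[OF assms] by (auto simp: rtrancl_power)
  then show ?thesis
    unfolding gdist_eq_Least_relpow[OF assms(1,3)] by (rule LeastI)
qed

lemma gdist_commute:
  assumes "pair_graph G" "strongly_connected G" "u \<in> pverts G" "v \<in> pverts G"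
  shows "gdist G u v = gdist G v u"
proof -
  interpret pair_graph G by fact
  have "gdist G y x \<le> gdist G x y" if "x \<in> pverts G" "y \<in> pverts G" for x y
  proof (rule gdist_le[OF assms(1) that(2)])
    have "(b, a) \<in> parcs G ^^ k" if "(a, b) \<in> parcs G ^^ k" for a b k
      using that
    proof (induction k arbitrary: b)
      case (Suc k)
      then obtain c where "(a, c) \<in> parcs G ^^ k" "(c, b) \<in> parcs G"
        by (auto elim: relpow_Suc_E)
      then show ?case
        using Suc.IH arcs_symmetric by (meson relpow_Suc_I2)
    qed simp
    with relpow_gdist[OF assms(1,2) that] show "(y, x) \<in> parcs G ^^ gdist G x y"
      by blast
  qed
  then show ?thesis using assms(3,4) by (meson le_antisym)
qed

text \<open>
  Every step of a walk in the product is a step in exactly one factor. Hence its two projections,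
  with the stationary steps removed, have lengths that add up to its length.
\<close>

lemma relpow_box_product_split:
  assumes "((g, h), (g', h')) \<in> parcs (G \<box> H) ^^ k"
  shows "\<exists>i j. i + j = k \<and> (g, g') \<in> parcs G ^^ i \<and> (h, h') \<in> parcs H ^^ j"
  using assms
proof (induction k arbitrary: g' h')
  case 0
  then show ?case by auto
next
  case (Suc k)
  then obtain a b where ab: "((g, h), (a, b)) \<in> parcs (G \<box> H) ^^ k"
    and st: "((a, b), (g', h')) \<in> parcs (G \<box> H)"
    by (metis relpow_Suc_E surj_pair)
  from Suc.IH[OF ab] obtain i j
    where ij: "i + j = k" "(g, a) \<in> parcs G ^^ i" "(h, b) \<in> parcs H ^^ j"
    by blast
  from st consider "(a, g') \<in> parcs G" "b = h'" | "a = g'" "(b, h') \<in> parcs H"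
    by (auto simp: box_product_def)
  then show ?case
  proof cases
    case 1
    with ij show ?thesis by (intro exI[of _ "Suc i"] exI[of _ j]) auto
  next
    case 2
    with ij show ?thesis by (intro exI[of _ i] exI[of _ "Suc j"]) auto
  qed
qed

lemma relpow_box_product_left:
  assumes "(g, g') \<in> parcs G ^^ i" "h \<in> pverts H"
  shows "((g, h), (g', h)) \<in> parcs (G \<box> H) ^^ i"
  using assms(1)
proof (induction i arbitrary: g')
  case (Suc i)
  then show ?case using assms(2)
    by (auto elim!: relpow_Suc_E intro!: relpow_Suc_I simp: box_product_def)
qed simp

lemma relpow_box_product_right:
  assumes "(h, h') \<in> parcs H ^^ j" "g \<in> pverts G"
  shows "((g, h), (g, h')) \<in> parcs (G \<box> H) ^^ j"
  using assms(1)
proof (induction j arbitrary: h')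
  case (Suc j)
  then show ?case using assms(2)
    by (auto elim!: relpow_Suc_E intro!: relpow_Suc_I simp: box_product_def)
qed simp

lemma gdist_box_product:
  assumes G: "pair_graph G" "strongly_connected G" and H: "pair_graph H" "strongly_connected H"
    and g: "g \<in> pverts G" "g' \<in> pverts G" and h: "h \<in> pverts H" "h' \<in> pverts H"
  shows "gdist (G \<box> H) (g, h) (g', h') = gdist G g g' + gdist H h h'"
proof (rule antisym)
  have gh: "(g, h) \<in> pverts (G \<box> H)" "(g', h') \<in> pverts (G \<box> H)"
    using g h by (auto simp: box_product_def)
  have "((g, h), (g', h)) \<in> parcs (G \<box> H) ^^ gdist G g g'"
    using relpow_box_product_left[OF relpow_gdist[OF G g] h(1)] .
  moreover have "((g', h), (g', h')) \<in> parcs (G \<box> H) ^^ gdist H h h'"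
    using relpow_box_product_right[OF relpow_gdist[OF H h] g(2)] .
  ultimately have "((g, h), (g', h')) \<in> parcs (G \<box> H) ^^ (gdist G g g' + gdist H h h')"
    by (auto simp: relpow_add)
  then show "gdist (G \<box> H) (g, h) (g', h') \<le> gdist G g g' + gdist H h h'"
    by (rule gdist_le[OF pair_graph_box_product[OF G(1) H(1)] gh(1)])
  have "((g, h), (g', h')) \<in> parcs (G \<box> H) ^^ gdist (G \<box> H) (g, h) (g', h')"
    by (rule relpow_gdist[OF pair_graph_box_product[OF G(1) H(1)]
          strongly_connected_box_product[OF G H] gh])
  from relpow_box_product_split[OF this]
  show "gdist G g g' + gdist H h h' \<le> gdist (G \<box> H) (g, h) (g', h')"
    using gdist_le[OF G(1) g(1)] gdist_le[OF H(1) h(1)] by (metis add_mono)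
qed

lemma gdist_eq_0_iff:
  assumes "pair_graph G" "strongly_connected G" "u \<in> pverts G" "v \<in> pverts G"
  shows "gdist G u v = 0 \<longleftrightarrow> u = v"
  using relpow_gdist[OF assms] gdist_le[OF assms(1,3), of v 0] by auto

lemma gdist_ge_2:
  assumes "pair_graph G" "strongly_connected G" "u \<in> pverts G" "v \<in> pverts G"
    and "u \<noteq> v" "(u, v) \<notin> parcs G"
  shows "gdist G u v \<ge> 2"
proof (rule ccontr)
  assume "\<not> ?thesis"
  then have "gdist G u v = 0 \<or> gdist G u v = 1" by linarith
  with relpow_gdist[OF assms(1-4)] assms(5,6) show False by auto
qed

section \<open>Distances in the Petersen graph and in stars\<close>

text \<open>
  Distance two in the Petersen graph, in a form that rewriting decides for concrete vertices.
\<close>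

definition petersen_far :: "petersen_vertex \<Rightarrow> petersen_vertex \<Rightarrow> bool" where
  "petersen_far g g' \<longleftrightarrow> g \<noteq> g' \<and> (g, g') \<notin> parcs petersen"

definition petersen_list :: "petersen_vertex list" where
  "petersen_list = [U 0, U 1, U 2, U 3, U 4, V 0, V 1, V 2, V 3, V 4]"

lemma set_petersen_list: "set petersen_list = pverts petersen"
proof -
  have "{..<5} = {0, 1, 2, 3, 4::nat}" by auto
  then show ?thesis by (auto simp: petersen_list_def petersen_def Let_def)
qed

text \<open>
  With these rules the simplifier decides adjacency of concrete vertices, so that a claim on all
  vertices of the list above is settled by rewriting.
\<close>

lemma petersen_arc_iff:
  "(U i, U j) \<in> parcs petersen \<longleftrightarrow> i < 5 \<and> j < 5 \<and> (j = (i + 1) mod 5 \<or> i = (j + 1) mod 5)"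
  "(U i, V j) \<in> parcs petersen \<longleftrightarrow> i < 5 \<and> i = j"
  "(V i, U j) \<in> parcs petersen \<longleftrightarrow> i < 5 \<and> i = j"
  "(V i, V j) \<in> parcs petersen \<longleftrightarrow> i < 5 \<and> j < 5 \<and> (j = (i + 2) mod 5 \<or> i = (j + 2) mod 5)"
  by (auto simp: petersen_def Let_def)

lemma gdist_petersen_le: 
  assumes "g \<in> pverts petersen" "g' \<in> pverts petersen"
  shows "gdist petersen g g' \<le> 2"
proof -
  have "\<forall>g\<in>set petersen_list. \<forall>g'\<in>set petersen_list. g = g' \<or> (g, g') \<in> parcs petersen
      \<or> (\<exists>w\<in>set petersen_list. (g, w) \<in> parcs petersen \<and> (w, g') \<in> parcs petersen)"
    by (simp add: petersen_list_def petersen_arc_iff)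
  then have "g = g' \<or> (g, g') \<in> parcs petersen
      \<or> (\<exists>w\<in>set petersen_list. (g, w) \<in> parcs petersen \<and> (w, g') \<in> parcs petersen)"
    using assms by (simp add: set_petersen_list)
  then have "\<exists>k\<le>2. (g, g') \<in> parcs petersen ^^ k"
  proof (elim disjE bexE conjE)
    assume "g = g'"
    then show ?thesis by (intro exI[of _ 0]) simp
  next
    assume "(g, g') \<in> parcs petersen"
    then show ?thesis by (intro exI[of _ 1]) simp
  next
    fix w assume "(g, w) \<in> parcs petersen" "(w, g') \<in> parcs petersen"
    then show ?thesis by (intro exI[of _ 2]) (auto simp: numeral_2_eq_2)
  qed
  then show ?thesis
    using gdist_le[OF pair_graph_petersen assms(1)] le_trans by blast
qed

lemma gdist_petersen_far:
  assumes "g \<in> pverts petersen" "g' \<in> pverts petersen" "petersen_far g g'"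
  shows "gdist petersen g g' = 2"
  using gdist_petersen_le[OF assms(1,2)] assms
    gdist_ge_2[OF pair_graph_petersen strongly_connected_petersen assms(1,2)]
  by (simp add: petersen_far_def)

lemma gdist_petersen_neq:
  assumes "g \<in> pverts petersen" "g' \<in> pverts petersen" "g \<noteq> g'"
  shows "gdist petersen g g' \<ge> 1"
  using gdist_eq_0_iff[OF pair_graph_petersen strongly_connected_petersen assms(1,2)] assms(3)
  by (simp add: Suc_le_eq)

lemma gdist_star:
  assumes "h \<le> n" "h' \<le> n"
  shows "gdist (star n) h h' =
    (if h = h' then 0 else if h = 0 \<or> h' = 0 then 1 else 2)"
proof -
  have h: "h \<in> pverts (star n)" "h' \<in> pverts (star n)"
    using assms by (auto simp: star_def Let_def)
  have arc: "(a, b) \<in> parcs (star n) \<longleftrightarrow> (a = 0) \<noteq> (b = 0) \<and> a \<le> n \<and> b \<le> n" for a b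
    by (auto simp: star_def Let_def)
  note sc = pair_graph_star[of n] strongly_connected_star[of n] h
  consider "h = h'" | "h \<noteq> h'" "h = 0 \<or> h' = 0" | "h \<noteq> h'" "h \<noteq> 0" "h' \<noteq> 0"
    by blast
  then show ?thesis
  proof cases
    case 1
    then show ?thesis using gdist_eq_0_iff[OF sc] by simp
  next
    case 2
    then have "(h, h') \<in> parcs (star n) ^^ 1" using assms by (auto simp: arc)
    then have "gdist (star n) h h' \<le> 1" by (rule gdist_le[OF sc(1) h(1)])
    then show ?thesis using 2 gdist_eq_0_iff[OF sc] by simp
  next
    case 3
    then have "(h, 0) \<in> parcs (star n)" "(0, h') \<in> parcs (star n)"
      using assms by (auto simp: arc)
    then have "(h, h') \<in> parcs (star n) ^^ 2" by (auto simp: numeral_2_eq_2)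
    then have "gdist (star n) h h' \<le> 2" by (rule gdist_le[OF sc(1) h(1)])
    moreover have "gdist (star n) h h' \<ge> 2"
      by (rule gdist_ge_2[OF sc]) (use 3 in \<open>auto simp: arc\<close>)
    ultimately show ?thesis using 3 by simp
  qed
qed

lemma pverts_petersen_box_star:
  "pverts (petersen \<box> star n) = pverts petersen \<times> {..n}"
  by (auto simp: box_product_def star_def Let_def)

lemma gdist_petersen_box_star:
  assumes "g \<in> pverts petersen" "g' \<in> pverts petersen" "h \<le> n" "h' \<le> n"
  shows "gdist (petersen \<box> star n) (g, h) (g', h') = gdist petersen g g' +
    (if h = h' then 0 else if h = 0 \<or> h' = 0 then 1 else 2)"
proof -
  have "h \<in> pverts (star n)" "h' \<in> pverts (star n)"
    using assms by (auto simp: star_def Let_def)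
  then show ?thesis
    using gdist_box_product[OF pair_graph_petersen strongly_connected_petersen
        pair_graph_star strongly_connected_star assms(1,2)] gdist_star[OF assms(3,4)]
    by simp
qed

lemma card_pverts_petersen: "card (pverts petersen) = 10"
proof -
  have "card (U ` {..<5} \<union> V ` {..<5}) = card (U ` {..<5}) + card (V ` {..<5})"
    by (rule card_Un_disjoint) auto
  then show ?thesis
    by (simp add: petersen_def Let_def card_image inj_on_def)
qed

lemma diam_petersen_box_star:
  assumes "n \<ge> 2"
  shows "diam (petersen \<box> star n) = 4"
proof -
  let ?D = "{gdist (petersen \<box> star n) u v | u v.
    u \<in> pverts (petersen \<box> star n) \<and> v \<in> pverts (petersen \<box> star n)}"
  have le: "d \<le> 4" if "d \<in> ?D" for d
  proof -
    from that obtain g h g' h' where "d = gdist (petersen \<box> star n) (g, h) (g', h')"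
      and "g \<in> pverts petersen" "g' \<in> pverts petersen" "h \<le> n" "h' \<le> n"
      by (auto simp: pverts_petersen_box_star)
    then show ?thesis
      using gdist_petersen_box_star[of g g' h n h'] gdist_petersen_le[of g g'] by auto
  qed
  have U: "U 0 \<in> pverts petersen" "U 2 \<in> pverts petersen"
    by (auto simp: petersen_def Let_def)
  have "petersen_far (U 0) (U 2)"
    by (auto simp: petersen_far_def petersen_arc_iff)
  then have "gdist (petersen \<box> star n) (U 0, 1) (U 2, 2) = 4"
    using gdist_petersen_far[OF U] gdist_petersen_box_star[OF U, of 1 n 2] assms by simp
  then have "4 \<in> ?D"
    using U assms by (force simp: pverts_petersen_box_star)
  moreover have "finite ?D"
    by (rule finite_subset[of _ "{..4}"]) (use le in blast)+
  ultimately show ?thesis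
    unfolding diam_def using le by (intro Max_eqI) auto
qed

section \<open>The lower bound\<close>

text \<open>
  Induction along increasing values of \<open>f\<close>: the new element \<open>m\<close> is the largest, and compared
  with the previous largest element \<open>y\<close> it adds at least $a - L(m) - L(y)$. For this the induction
  carries the levels of the smallest and of the largest element, which are counted only once.
\<close>

lemma spread_lower_bound:
  fixes f L :: "'a \<Rightarrow> int"
  assumes "finite S" "S \<noteq> {}"
    and "\<And>x. x \<in> S \<Longrightarrow> L x \<ge> 0"
    and "\<And>x y. x \<in> S \<Longrightarrow> y \<in> S \<Longrightarrow> x \<noteq> y \<Longrightarrow> \<bar>f x - f y\<bar> \<ge> a - L x - L y"
  shows "\<exists>x\<in>S. \<exists>y\<in>S. f y - f x \<ge> a * (int (card S) - 1) - 2 * sum L S"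
proof -
  have "\<exists>x\<in>S. \<exists>y\<in>S. (\<forall>z\<in>S. f z \<le> f y) \<and>
      f y - f x \<ge> a * (int (card S) - 1) - 2 * sum L S + L x + L y"
    using assms
  proof (induction rule: finite_ranking_induct[where f = f])
    case empty
    then show ?case by simp
  next
    case (insert m S)
    show ?case
    proof (cases "S = {} \<or> m \<in> S")
      case True
      then consider "S = {}" | "m \<in> S" by blast
      then show ?thesis
      proof cases
        case 1
        then show ?thesis by simp
      next
        case 2
        then have "insert m S = S" "S \<noteq> {}" by auto
        then show ?thesis using insert.IH insert.prems by simp
      qed
    next
      case False
      with insert obtain x y where xy: "x \<in> S" "y \<in> S" "\<forall>z\<in>S. f z \<le> f y"
        "f y - f x \<ge> a * (int (card S) - 1) - 2 * sum L S + L x + L y"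
        by (metis (no_types, lifting) insertCI)
      have "\<bar>f m - f y\<bar> \<ge> a - L m - L y"
        using insert.prems xy(2) False by blast
      moreover have "f y \<le> f m" using insert.hyps xy(2) by blast
      ultimately have "f m - f x \<ge> a * (int (card (insert m S)) - 1) - 2 * sum L (insert m S)
          + L x + L m"
        using xy(4) insert.hyps(1) False by (simp add: algebra_simps)
      moreover have "\<forall>z\<in>insert m S. f z \<le> f m"
        using insert.hyps by blast
      ultimately show ?thesis
        using xy(1) by blast
    qed
  qed
  moreover have "L x \<ge> 0" if "x \<in> S" for x
    using assms(3) that .
  ultimately show ?thesis
    by (smt (verit, best))
qed

lemma finite_label_differences:
  assumes "finite (verts G)"
  shows "finite {nat \<bar>int (f u) - int (f v)\<bar> | u v. u \<in> verts G \<and> v \<in> verts G}"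
  by (rule finite_image_set2) (use assms in simp_all)

lemma label_span_ge_weighted:
  fixes L :: "'a \<Rightarrow> nat"
  assumes "finite (verts G)" "verts G \<noteq> {}" "radio_labeling G f"
    and "\<And>u v. u \<in> verts G \<Longrightarrow> v \<in> verts G \<Longrightarrow> gdist G u v \<le> c + L u + L v"
  shows "int (label_span G f) \<ge>
    (int (diam G) + 1 - int c) * (int (card (verts G)) - 1) - 2 * (\<Sum>v\<in>verts G. int (L v))"
proof -
  obtain x y where xy: "x \<in> verts G" "y \<in> verts G"
    and ge: "int (f y) - int (f x) \<ge>
      (int (diam G) + 1 - int c) * (int (card (verts G)) - 1) - 2 * (\<Sum>v\<in>verts G. int (L v))"
  proof -
    have "\<exists>x\<in>verts G. \<exists>y\<in>verts G. int (f y) - int (f x) \<ge>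
      (int (diam G) + 1 - int c) * (int (card (verts G)) - 1) - 2 * (\<Sum>v\<in>verts G. int (L v))"
    proof (rule spread_lower_bound[OF assms(1,2)])
      fix u v assume "u \<in> verts G" "v \<in> verts G" "u \<noteq> v"
      with assms(3) assms(4)[of u v]
      show "\<bar>int (f u) - int (f v)\<bar> \<ge> int (diam G) + 1 - int c - int (L u) - int (L v)"
        by (fastforce simp: radio_labeling_def)
    qed simp
    then show thesis using that by blast
  qed
  have "nat \<bar>int (f y) - int (f x)\<bar> \<le> label_span G f"
    unfolding label_span_def
    by (rule Max_ge[OF finite_label_differences[OF assms(1)]]) (use xy in auto)
  then show ?thesis using ge by linarith
qed

lemma label_span_petersen_box_star_ge:
  assumes "n \<ge> 2" "radio_labeling (petersen \<box> star n) f"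
  shows "label_span (petersen \<box> star n) f \<ge> 10 * n + 27"
proof -
  define L :: "petersen_vertex \<times> nat \<Rightarrow> nat" where "L = (\<lambda>(g, h). if h = 0 then 0 else 1)"
  interpret pair_graph "petersen \<box> star n"
    by (rule pair_graph_box_product[OF pair_graph_petersen pair_graph_star])
  have "(\<Sum>v\<in>pverts petersen \<times> {..n}. int (L v)) = (\<Sum>g\<in>pverts petersen. \<Sum>h\<le>n. int (L (g, h)))"
    by (simp add: sum.cartesian_product)
  also have "\<dots> = 10 * int n"
    by (simp add: L_def sum.atMost_shift card_pverts_petersen)
  finally have sum: "(\<Sum>v\<in>pverts petersen \<times> {..n}. int (L v)) = 10 * int n" .
  have "int (label_span (petersen \<box> star n) f) \<ge>
      (int (diam (petersen \<box> star n)) + 1 - int 2) * (int (card (verts (petersen \<box> star n))) - 1)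
      - 2 * (\<Sum>v\<in>verts (petersen \<box> star n). int (L v))"
  proof (rule label_span_ge_weighted[OF _ _ assms(2)])
    show "gdist (petersen \<box> star n) u v \<le> 2 + L u + L v"
      if "u \<in> verts (petersen \<box> star n)" "v \<in> verts (petersen \<box> star n)" for u v
      using that gdist_petersen_le[of "fst u" "fst v"]
        gdist_petersen_box_star[of "fst u" "fst v" "snd u" n "snd v"]
      by (auto simp: pverts_petersen_box_star L_def)
    show "verts (petersen \<box> star n) \<noteq> {}"
      using card_pverts_petersen by (auto simp: pverts_petersen_box_star)
  qed simp
  then show ?thesis
    using assms(1)
    by (simp add: pverts_petersen_box_star card_cartesian_product card_pverts_petersen sum
        diam_petersen_box_star)
qed

section \<open>An optimal labeling\<close>

text \<open>
  \<open>row c g\<close> is the row in which the Petersen vertex \<open>g\<close> stands in a column of kind \<open>c\<close>. Read in the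
  other direction, with indices modulo $5$, the entries of kinds $0, 1, 2, 3$ are
  $u_k, v_{k+1}, u_{k+2}, v_{k+3}$ in row $2k$ and $v_{k+4}, u_{k+3}, v_k, u_{k+3}$ in row $2k + 1$.
  Rotation of the Petersen graph by one shifts the table by two rows.
\<close>

fun row :: "nat \<Rightarrow> petersen_vertex \<Rightarrow> nat" where
  "row c (U i) = (2 * i + [0, 5, 6, 5] ! c) mod 10"
| "row c (V i) = (2 * i + [3, 8, 1, 4] ! c) mod 10"

text \<open>
  The kinds repeat with period three. If \<open>n\<close> is congruent to $2$ modulo $3$, the last column would
  be of kind $1$, and this is not possible: its entry $v_{k+1}$ in row $2k$ is adjacent to the first
  entry $v_{k+4}$ of the next row. Kind $3$ takes its place there.
\<close>

definition column :: "nat \<Rightarrow> nat \<Rightarrow> nat" where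
  "column n j = (if n mod 3 = 2 \<and> j = n - 1 then 3 else j mod 3)"

lemma row_less: "row c g < 10"
  by (cases g) simp_all

lemma petersen_checkI:
  assumes "list_all (\<lambda>g. list_all (P g) petersen_list) petersen_list"
    and "g \<in> pverts petersen" "g' \<in> pverts petersen"
  shows "P g g'"
  using assms by (simp add: list_all_iff set_petersen_list)

lemma row_inj:
  assumes "g \<in> pverts petersen" "g' \<in> pverts petersen" "c < 4" "row c g = row c g'"
  shows "g = g'"
proof -
  have "\<forall>c\<in>{0, 1, 2, 3}. row c g = row c g' \<longrightarrow> g = g'"
    by (rule petersen_checkI[OF _ assms(1,2)]) (simp add: petersen_list_def)
  moreover have "c \<in> {0, 1, 2, 3}" using assms(3) by auto
  ultimately show ?thesis using assms(4) by blast
qed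

text \<open>
  The pairs are the possible kinds of two columns next to each other. Their labels in a row differ
  by one, so the distance has to be the largest possible one.
\<close>

lemma same_row_far:
  assumes "g \<in> pverts petersen" "g' \<in> pverts petersen"
    and "(c, c') \<in> {(0, 1), (1, 2), (2, 0), (0, 3)}" "row c g = row c' g'"
  shows "petersen_far g g'"
proof -
  have "\<forall>(c, c')\<in>{(0, 1), (1, 2), (2, 0), (0, 3)}. row c g = row c' g' \<longrightarrow> petersen_far g g'"
    by (rule petersen_checkI[OF _ assms(1,2)])
      (simp add: petersen_list_def petersen_far_def petersen_arc_iff)
  then show ?thesis using assms(3,4) by blast
qed

text \<open>
  The pairs are the possible kinds of two columns with one column in between. Their labels in a row
  differ by two, so adjacent Petersen vertices would do, but equal ones would not.
\<close>

lemma same_row_neq: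
  assumes "g \<in> pverts petersen" "g' \<in> pverts petersen"
    and "(c, c') \<in> {(0, 2), (1, 0), (2, 1), (2, 3)}" "row c g = row c' g'"
  shows "g \<noteq> g'"
proof -
  have "\<forall>(c, c')\<in>{(0, 2), (1, 0), (2, 1), (2, 3)}. row c g = row c' g' \<longrightarrow> g \<noteq> g'"
    by (rule petersen_checkI[OF _ assms(1,2)]) (simp add: petersen_list_def)
  then show ?thesis using assms(3,4) by blast
qed

text \<open>
  The pairs \<open>(0, 0)\<close>, \<open>(2, 0)\<close> and \<open>(3, 0)\<close> are those of the last and the first column. The pairs of
  equal kinds other than $3$ serve \<open>n = 3\<close>, where the labels of adjacent entries of one column
  differ by three only. Counting rows modulo $10$ makes the first row follow the last, which is
  what the vertices over the centre need.
\<close>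

lemma next_row_far:
  assumes "g \<in> pverts petersen" "g' \<in> pverts petersen"
    and "(c, c') \<in> {(0, 0), (1, 1), (2, 2), (2, 0), (3, 0)}"
    and "row c' g' = (row c g + 1) mod 10"
  shows "petersen_far g g'"
proof -
  have "\<forall>(c, c')\<in>{(0, 0), (1, 1), (2, 2), (2, 0), (3, 0)}.
      row c' g' = (row c g + 1) mod 10 \<longrightarrow> petersen_far g g'"
    by (rule petersen_checkI[OF _ assms(1,2)])
      (simp add: petersen_list_def petersen_far_def petersen_arc_iff)
  then show ?thesis using assms(3,4) by blast
qed

text \<open>
  Two steps apart over the end of a row are the last but one column and the first, and the last
  column and the second.
\<close>

lemma next_row_neq:
  assumes "g \<in> pverts petersen" "g' \<in> pverts petersen"
    and "(c, c') \<in> {(0, 0), (1, 0), (2, 0), (0, 1), (2, 1), (3, 1)}"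
    and "row c' g' = (row c g + 1) mod 10"
  shows "g \<noteq> g'"
proof -
  have "\<forall>(c, c')\<in>{(0, 0), (1, 0), (2, 0), (0, 1), (2, 1), (3, 1)}.
      row c' g' = (row c g + 1) mod 10 \<longrightarrow> g \<noteq> g'"
    by (rule petersen_checkI[OF _ assms(1,2)]) (simp add: petersen_list_def)
  then show ?thesis using assms(3,4) by blast
qed

lemma mod_3_cases:
  fixes j :: nat
  obtains "j mod 3 = 0" | "j mod 3 = Suc 0" | "j mod 3 = 2"
proof -
  have "j mod 3 < 3" by simp
  then have "j mod 3 = 0 \<or> j mod 3 = Suc 0 \<or> j mod 3 = 2" by linarith
  then show thesis using that by metis
qed

lemma column_less: "column n j < 4"
  by (rule mod_3_cases[of j]) (simp_all add: column_def)

lemma column_first: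
  assumes "n \<ge> 3"
  shows "column n 0 = 0" "column n (Suc 0) = 1"
proof -
  have "0 \<noteq> n - 1" "Suc 0 \<noteq> n - 1" using assms by linarith+
  then show "column n 0 = 0" "column n (Suc 0) = 1" by (simp_all add: column_def)
qed

lemma column_step:
  assumes "Suc j < n"
  shows "(column n j, column n (Suc j)) \<in> {(0, 1), (1, 2), (2, 0), (0, 3)}"
proof (cases "n = Suc (Suc j)")
  case True
  then show ?thesis by (cases j rule: mod_3_cases) (simp_all add: column_def mod_Suc)
next
  case False
  then have "j \<noteq> n - 1" "Suc j \<noteq> n - 1" using assms by simp_all
  then show ?thesis by (cases j rule: mod_3_cases) (simp_all add: column_def mod_Suc)
qed

lemma column_step2:
  assumes "j + 2 < n"
  shows "(column n j, column n (j + 2)) \<in> {(0, 2), (1, 0), (2, 1), (2, 3)}"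
proof (cases "n = Suc (Suc (Suc j))")
  case True
  then show ?thesis by (cases j rule: mod_3_cases) (simp_all add: column_def mod_Suc)
next
  case False
  then have "j \<noteq> n - 1" "Suc (Suc j) \<noteq> n - 1" using assms by simp_all
  then show ?thesis by (cases j rule: mod_3_cases) (simp_all add: column_def mod_Suc)
qed

lemma column_last:
  assumes "n \<ge> 3"
  shows "column n (n - 1) \<in> {0, 2, 3}"
proof -
  obtain m where "n = Suc m" using assms by (cases n) simp_all
  then show ?thesis by (cases m rule: mod_3_cases) (simp_all add: column_def mod_Suc)
qed

lemma column_penultimate:
  assumes "n \<ge> 3"
  shows "column n (n - 2) \<in> {0, 1, 2}"
proof -
  have "n - 2 \<noteq> n - 1" using assms by linarith
  then show ?thesis by (cases "n - 2" rule: mod_3_cases) (simp_all add: column_def)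
qed

text \<open>
  A step between a vertex over the centre and one over a leaf costs $2$, a step between two vertices
  over the centre costs $3$. Thus the vertex over the centre with row $9$ takes the label $0$, the table
  the labels from $2$ to $10n + 1$, and the other nine vertices over the centre the labels from
  $10n + 3$ on in steps of three. In the order of rows modulo $10$, row $9$ stands right before
  the beginning of the table and row $0$ right after its end.
\<close>

definition leaf_label :: "nat \<Rightarrow> petersen_vertex \<Rightarrow> nat \<Rightarrow> nat" where
  "leaf_label n g j = 2 + n * row (column n j) g + j"

definition centre_label :: "nat \<Rightarrow> petersen_vertex \<Rightarrow> nat" where
  "centre_label n g = (if row 0 g = 9 then 0 else 10 * n + 3 + 3 * row 0 g)"

definition labeling :: "nat \<Rightarrow> petersen_vertex \<times> nat \<Rightarrow> nat" where
  "labeling n = (\<lambda>(g, h). if h = 0 then centre_label n g else leaf_label n g (h - 1))"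

lemma leaf_label_le:
  assumes "j < n"
  shows "leaf_label n g j \<le> 10 * n + 1"
proof -
  have "n * row (column n j) g \<le> n * 9"
    using row_less[of "column n j" g] by (intro mult_left_mono) auto
  then have "2 + n * row (column n j) g + j \<le> 10 * n + 1" using assms by linarith
  then show ?thesis by (simp add: leaf_label_def)
qed

lemma centre_label_le: "centre_label n g \<le> 10 * n + 27"
  using row_less[of 0 g] by (auto simp: centre_label_def)

text \<open>
  The claim is trivial for a label difference of at least four. Since a row has at least three
  entries, a smaller difference occurs only within a row or between neighbouring rows.
\<close>

lemma leaf_labels_apart:
  assumes n: "n \<ge> 3" and g: "g \<in> pverts petersen" "g' \<in> pverts petersen"
    and j: "j < n" "j' < n" and neq: "(g, j) \<noteq> (g', j')"
    and le: "leaf_label n g j \<le> leaf_label n g' j'"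
  shows "leaf_label n g' j' + (gdist petersen g g' + (if j = j' then 0 else 2))
    \<ge> leaf_label n g j + 5"
proof -
  define r r' where "r = row (column n j) g" and "r' = row (column n j') g'"
  have lab: "leaf_label n g j = 2 + n * r + j" "leaf_label n g' j' = 2 + n * r' + j'"
    by (simp_all add: leaf_label_def r_def r'_def)
  note far = gdist_petersen_far[OF g] and ne = gdist_petersen_neq[OF g]
  have "r \<le> r'"
  proof (rule ccontr)
    assume "\<not> ?thesis"
    then have "n * (r' + 1) \<le> n * r" by (intro mult_left_mono) auto
    then show False using le lab j by (simp add: algebra_simps)
  qed
  then consider "r' = r" | "r' = r + 1" | "r + 2 \<le> r'" by linarith
  then show ?thesis
  proof cases
    case 1
    have "j \<noteq> j'"
      using neq row_inj[OF g column_less, of n j] 1 by (auto simp: r_def r'_def)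
    with le lab 1 have "j < j'" by simp
    then consider "j' = Suc j" | "j' = j + 2" | "j' \<ge> j + 3" by linarith
    then show ?thesis
    proof cases
      case 1
      then have "petersen_far g g'"
        using same_row_far[OF g column_step] j \<open>r' = r\<close> by (simp add: r_def r'_def)
      then show ?thesis using far lab \<open>r' = r\<close> 1 by simp
    next
      case 2
      then have "g \<noteq> g'"
        using same_row_neq[OF g column_step2] j \<open>r' = r\<close> by (simp add: r_def r'_def)
      then show ?thesis using ne lab \<open>r' = r\<close> 2 by simp
    next
      case 3
      then show ?thesis using lab \<open>r' = r\<close> by simp
    qed
  next
    case 2
    then have step: "row (column n j') g' = (row (column n j) g + 1) mod 10"
      using row_less[of "column n j'" g'] by (simp add: r_def r'_def)
    have lab': "leaf_label n g' j' + j = leaf_label n g j + n + j'"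
      using lab 2 by simp
    have bound: ?thesis if "petersen_far g g'" "j \<noteq> j'"
      using far[OF that(1)] that(2) lab' j by simp
    (* Fewer than three steps apart over the end of a row. *)
    have near: "j' = 0 \<and> (j = n - 1 \<or> j = n - 2) \<or> j' = 1 \<and> j = n - 1" if "n + j' < j + 3"
    proof -
      have "j' = 0 \<or> j' = 1" using that j by linarith
      then show ?thesis using that j by (elim disjE) linarith+
    qed
    have "n = 3 \<or> n \<ge> 4" using n by linarith
    then consider "j = j'" "n = 3" | "j = j'" "n \<ge> 4"
      | "j \<noteq> j'" "j = n - 1" "j' = 0" | "j \<noteq> j'" "j = n - 1" "j' = 1"
      | "j \<noteq> j'" "j = n - 2" "j' = 0" | "j \<noteq> j'" "n + j' \<ge> j + 3"
      using near not_less by blast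
    then show ?thesis
    proof cases
      case 1
      then have "(column n j, column n j') \<in> {(0, 0), (1, 1), (2, 2)}"
        using j by (auto simp: column_def)
      then have "petersen_far g g'" using next_row_far[OF g _ step] by blast
      then show ?thesis using far lab' 1 by simp
    next
      case 2
      then have "g \<noteq> g'" using neq by simp
      then show ?thesis using ne lab' 2 by auto
    next
      case 3
      then have "(column n j, column n j') \<in> {(0, 0), (2, 0), (3, 0)}"
        using column_last[OF n] column_first[OF n] by auto
      then have "petersen_far g g'" using next_row_far[OF g _ step] by blast
      then show ?thesis using bound 3 by blast
    next
      case 4
      then have "(column n j, column n j') \<in> {(0, 1), (2, 1), (3, 1)}"
        using column_last[OF n] column_first[OF n] by auto
      then have "g \<noteq> g'" using next_row_neq[OF g _ step] by blast
      then show ?thesis using ne lab' 4 n by auto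
    next
      case 5
      then have "(column n j, column n j') \<in> {(0, 0), (1, 0), (2, 0)}"
        using column_penultimate[OF n] column_first[OF n] by auto
      then have "g \<noteq> g'" using next_row_neq[OF g _ step] by blast
      then show ?thesis using ne lab' 5 n by auto
    next
      case 6
      then show ?thesis using lab' by auto
    qed
  next
    case 3
    then have "n * (r + 2) \<le> n * r'" by (intro mult_left_mono) auto
    then show ?thesis using lab j n by (auto simp: algebra_simps)
  qed
qed

lemma centre_labels_apart:
  assumes g: "g \<in> pverts petersen" "g' \<in> pverts petersen" and neq: "g \<noteq> g'" and n: "n \<ge> 1"
    and le: "centre_label n g \<le> centre_label n g'"
  shows "centre_label n g' + gdist petersen g g' \<ge> centre_label n g + 5"
proof -
  have ne: "row 0 g \<noteq> row 0 g'" using row_inj[OF g, of 0] neq by auto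
  consider "row 0 g = 9" | "row 0 g \<noteq> 9" "row 0 g' = row 0 g + 1" "row 0 g' \<noteq> 9"
    | "row 0 g \<noteq> 9" "row 0 g' \<ge> row 0 g + 2" "row 0 g' \<noteq> 9"
  proof -
    have "row 0 g < row 0 g' \<and> row 0 g' \<noteq> 9" if "row 0 g \<noteq> 9"
      using le that ne unfolding centre_label_def by (cases "row 0 g' = 9") simp_all
    moreover have "row 0 g' = row 0 g + 1 \<or> row 0 g' \<ge> row 0 g + 2" if "row 0 g < row 0 g'"
      using that by linarith
    ultimately show thesis using that by blast
  qed
  then show ?thesis
  proof cases
    case 1
    then show ?thesis using ne n by (simp add: centre_label_def)
  next
    case 2
    then have "row 0 g' = (row 0 g + 1) mod 10"
      using row_less[of 0 g'] by simp
    then have "petersen_far g g'" using next_row_far[OF g, of 0 0] by simp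
    then show ?thesis
      using gdist_petersen_far[OF g] 2 by (simp add: centre_label_def)
  next
    case 3
    then show ?thesis by (simp add: centre_label_def)
  qed
qed

lemma leaf_after_centre:
  assumes n: "n \<ge> 3" and g: "g \<in> pverts petersen" "g' \<in> pverts petersen" and j: "j < n"
    and le: "centre_label n g \<le> leaf_label n g' j"
  shows "leaf_label n g' j + (gdist petersen g g' + 1) \<ge> centre_label n g + 5"
proof -
  have r: "row 0 g = 9"
    using le leaf_label_le[OF j, of g'] by (simp add: centre_label_def split: if_splits)
  then have c: "centre_label n g = 0" by (simp add: centre_label_def)
  define r' where "r' = row (column n j) g'"
  have lab: "leaf_label n g' j = 2 + n * r' + j"
    by (simp add: leaf_label_def r'_def)
  consider "r' = 0" "j = 0" | "r' = 0" "j = Suc 0" | "leaf_label n g' j \<ge> 4"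
  proof -
    have "leaf_label n g' j \<ge> 4" if "r' \<noteq> 0"
    proof -
      have "n * 1 \<le> n * r'" using that by (intro mult_left_mono) auto
      then show ?thesis using lab n by linarith
    qed
    moreover have "leaf_label n g' j \<ge> 4" if "j \<ge> 2"
      using that lab by simp
    moreover have "j = 0 \<or> j = Suc 0 \<or> j \<ge> 2" by linarith
    ultimately show thesis using that by blast
  qed
  then show ?thesis
  proof cases
    case 1
    then have "petersen_far g g'"
      using next_row_far[OF g, of 0 0] column_first[OF n] r by (simp add: r'_def)
    then show ?thesis using gdist_petersen_far[OF g] c lab by simp
  next
    case 2
    then have "g \<noteq> g'"
      using next_row_neq[OF g, of 0 1] column_first[OF n] r by (simp add: r'_def)
    then show ?thesis using gdist_petersen_neq[OF g] c lab 2 by simp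
  next
    case 3
    then show ?thesis using c by simp
  qed
qed

lemma centre_after_leaf:
  assumes n: "n \<ge> 3" and g: "g \<in> pverts petersen" "g' \<in> pverts petersen" and j: "j < n"
    and le: "leaf_label n g j \<le> centre_label n g'"
  shows "centre_label n g' + (gdist petersen g g' + 1) \<ge> leaf_label n g j + 5"
proof -
  define r where "r = row (column n j) g"
  have lab: "leaf_label n g j = 2 + n * r + j"
    by (simp add: leaf_label_def r_def)
  have c: "centre_label n g' = 10 * n + 3 + 3 * row 0 g'"
    using le lab by (auto simp: centre_label_def)
  have r9: "r \<le> 9" using row_less[of "column n j" g] by (simp add: r_def)
  have "centre_label n g' \<ge> leaf_label n g j + 4" if "r \<noteq> 9"
  proof -
    have "n * r \<le> n * 8" using that r9 by (intro mult_left_mono) auto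
    then show ?thesis using lab c n j by linarith
  qed
  moreover have "centre_label n g' \<ge> leaf_label n g j + 4" if "row 0 g' \<noteq> 0 \<or> j + 3 \<le> n"
  proof -
    have "n * r \<le> n * 9" using r9 by (intro mult_left_mono) auto
    then show ?thesis using that lab c j by linarith
  qed
  moreover have "j = n - 1 \<or> j = n - 2 \<or> j + 3 \<le> n" using j by linarith
  ultimately consider "r = 9" "j = n - 1" "row 0 g' = 0" | "r = 9" "j = n - 2" "row 0 g' = 0"
    | "centre_label n g' \<ge> leaf_label n g j + 4"
    by blast
  then show ?thesis
  proof cases
    case 1
    then have "petersen_far g g'"
      using next_row_far[OF g, of "column n j" 0] column_last[OF n] by (auto simp: r_def)
    then show ?thesis using gdist_petersen_far[OF g] c lab 1 n by simp
  next
    case 2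
    then have "g \<noteq> g'"
      using next_row_neq[OF g, of "column n j" 0] column_penultimate[OF n] by (auto simp: r_def)
    then show ?thesis using gdist_petersen_neq[OF g] c lab 2 n by simp
  next
    case 3
    then show ?thesis by simp
  qed
qed

lemma radio_labeling_labeling:
  assumes n: "n \<ge> 3"
  shows "radio_labeling (petersen \<box> star n) (labeling n)"
proof -
  let ?G = "petersen \<box> star n"
  have pg: "pair_graph ?G" "strongly_connected ?G"
    by (simp_all add: pair_graph_box_product pair_graph_petersen pair_graph_star
        strongly_connected_box_product strongly_connected_petersen strongly_connected_star)
  have ordered: "labeling n v + gdist ?G u v \<ge> labeling n u + 5"
    if u: "u \<in> pverts ?G" and v: "v \<in> pverts ?G" and "u \<noteq> v" and le: "labeling n u \<le> labeling n v"
    for u v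
  proof -
    obtain g h g' h' where uv: "u = (g, h)" "v = (g', h')"
      by fastforce
    have gh: "g \<in> pverts petersen" "g' \<in> pverts petersen" "h \<le> n" "h' \<le> n"
      using u v uv by (auto simp: pverts_petersen_box_star)
    note dist = gdist_petersen_box_star[OF gh]
    show ?thesis
    proof (cases h; cases h')
      assume "h = 0" "h' = 0"
      then show ?thesis
        using centre_labels_apart[OF gh(1,2), of n] le n \<open>u \<noteq> v\<close> uv dist
        by (simp add: labeling_def)
    next
      fix j' assume "h = 0" "h' = Suc j'"
      then show ?thesis
        using leaf_after_centre[OF n gh(1,2), of j'] le gh(4) uv dist
        by (simp add: labeling_def)
    next
      fix j assume "h = Suc j" "h' = 0"
      then show ?thesis
        using centre_after_leaf[OF n gh(1,2), of j] le gh(3) uv dist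
        by (simp add: labeling_def)
    next
      fix j j' assume "h = Suc j" "h' = Suc j'"
      then show ?thesis
        using leaf_labels_apart[OF n gh(1,2), of j j'] le gh(3,4) \<open>u \<noteq> v\<close> uv dist
        by (auto simp: labeling_def)
    qed
  qed
  have "\<bar>int (labeling n u) - int (labeling n v)\<bar> \<ge> int (diam ?G) + 1 - int (gdist ?G u v)"
    if "u \<in> pverts ?G" "v \<in> pverts ?G" "u \<noteq> v" for u v
  proof (cases "labeling n u \<le> labeling n v")
    case True
    then show ?thesis
      using ordered[OF that] n by (simp add: diam_petersen_box_star)
  next
    case False
    then show ?thesis
      using ordered[OF that(2,1)] that gdist_commute[OF pg that(1,2)] n
      by (simp add: diam_petersen_box_star)
  qed
  then show ?thesis by (simp add: radio_labeling_def)
qed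

lemma labeling_le:
  assumes "v \<in> pverts (petersen \<box> star n)"
  shows "labeling n v \<le> 10 * n + 27"
proof -
  obtain g h where v: "v = (g, h)" "h \<le> n"
    using assms by (auto simp: pverts_petersen_box_star)
  show ?thesis
  proof (cases h)
    case 0
    then show ?thesis using v centre_label_le by (simp add: labeling_def)
  next
    case (Suc j)
    then have "leaf_label n g j \<le> 10 * n + 1" using v by (intro leaf_label_le) simp
    then show ?thesis using v Suc by (simp add: labeling_def)
  qed
qed

lemma label_span_le:
  assumes "finite (verts G)" "verts G \<noteq> {}" "\<And>v. v \<in> verts G \<Longrightarrow> f v \<le> m"
  shows "label_span G f \<le> m"
  unfolding label_span_def
proof (rule Max.boundedI[OF finite_label_differences[OF assms(1)]])
  show "{nat \<bar>int (f u) - int (f v)\<bar> | u v. u \<in> verts G \<and> v \<in> verts G} \<noteq> {}"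
    using assms(2) by blast
next
  fix d assume "d \<in> {nat \<bar>int (f u) - int (f v)\<bar> | u v. u \<in> verts G \<and> v \<in> verts G}"
  then obtain u v where "u \<in> verts G" "v \<in> verts G" "d = nat \<bar>int (f u) - int (f v)\<bar>"
    by blast
  then show "d \<le> m" using assms(3)[of u] assms(3)[of v] by linarith
qed

theorem theorem3p4:
  fixes n :: nat
  assumes "n \<ge> 3"
  shows "radio_number (petersen \<box> star n) = 10 * n + 27"
proof (rule antisym)
  let ?G = "petersen \<box> star n"
  interpret pair_graph ?G
    by (rule pair_graph_box_product[OF pair_graph_petersen pair_graph_star])
  have "label_span ?G (labeling n) \<le> 10 * n + 27"
  proof (rule label_span_le)
    show "verts ?G \<noteq> {}"
      using card_pverts_petersen by (auto simp: pverts_petersen_box_star)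
  qed (simp_all add: labeling_le)
  moreover have "radio_number ?G \<le> label_span ?G (labeling n)"
    unfolding radio_number_def
    by (rule cInf_lower) (use radio_labeling_labeling[OF assms] in auto)
  ultimately show "radio_number ?G \<le> 10 * n + 27" by simp
  show "10 * n + 27 \<le> radio_number ?G"
    unfolding radio_number_def
    by (rule cInf_greatest)
      (use radio_labeling_labeling[OF assms] label_span_petersen_box_star_ge[of n] assms in auto)
qed

end
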